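(* Let $\kappa,T_h>0$, $0<\delta_{\min}<\delta_{\max}$, $\epsilon=\delta_{\max}-\delta_{\min}$, $p_0\in[0,1]$ be fixed. For $\tau>0$ let $$\mu_W(\tau)=W_{iso}^{T_h}+\frac{W_{ad}}{\kappa\tau}\big(1-e^{-\kappa\tau}\big)-\frac{\epsilon}{\kappa\tau}\Big\{\mathcal{G}_\tau(\tau)-e^{-\kappa\tau}\mathcal{G}_\tau(0)\Big\}$$ be the average work done by a two-level system whose gap is driven linearly from $\delta_{\max}$ to $\delta_{\min}$ in time $\tau$ while partially thermalizing with a bath at temperature $T_h$. Then $$\lim_{\tau\to0}\mu_W(\tau)=W_{ad}\qquad\text{and}\qquad\lim_{\tau\to\infty}\mu_W(\tau)=W_{iso}^{T_h}.$$
   Context: Here $Z(\delta)=1+e^{-\delta/T_h}$, $W_{iso}^{T_h}=T_h\log\big(Z(\delta_{\min})/Z(\delta_{\max})\big)$ (isothermal work), $W_{ad}=\epsilon p_0$ (average adiabatic work), where $p_0$ is the initial excited-state probability. With $\delta(t)=\delta_{\max}-\epsilon t/\tau$ for $t\in[0,\tau]$, $$\mathcal{G}_\tau(t)=-\sum_{n=1}^\infty\frac{\big(-e^{-\delta(t)/T_h}\big)^n}{\frac{n\epsilon}{\kappa\tau T_h}+1},$$ so that $\delta(0)=\delta_{\max}$ and $\delta(\tau)=\delta_{\min}$. *)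

theory Defs
  imports Complex_Main
begin

text \<open>Units with Boltzmann constant equal to 1. Throughout, \<open>\<epsilon> = \<delta>\<^sub>m\<^sub>a\<^sub>x - \<delta>\<^sub>m\<^sub>i\<^sub>n\<close> is written out as
  the difference \<open>dmax - dmin\<close>, and \<open>Th\<close> is the temperature of the bath.\<close>

definition partition_fun :: "real \<Rightarrow> real \<Rightarrow> real" where
  "partition_fun Th d = 1 + exp (- d / Th)"

definition W_iso :: "real \<Rightarrow> real \<Rightarrow> real \<Rightarrow> real" where
  "W_iso Th dmin dmax = Th * ln (partition_fun Th dmin / partition_fun Th dmax)"

definition W_ad :: "real \<Rightarrow> real \<Rightarrow> real \<Rightarrow> real" where
  "W_ad dmin dmax p0 = (dmax - dmin) * p0"

definition gap :: "real \<Rightarrow> real \<Rightarrow> real \<Rightarrow> real \<Rightarrow> real" where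
  "gap dmin dmax \<tau> t = dmax - (dmax - dmin) * t / \<tau>"

text \<open>The series starts at \<open>n = 1\<close>, hence the index shift \<open>Suc n\<close>.\<close>

definition G_series :: "real \<Rightarrow> real \<Rightarrow> real \<Rightarrow> real \<Rightarrow> real \<Rightarrow> real \<Rightarrow> real" where
  "G_series \<kappa> Th dmin dmax \<tau> t =
     - (\<Sum>n. (- exp (- gap dmin dmax \<tau> t / Th)) ^ Suc n
            / (real (Suc n) * (dmax - dmin) / (\<kappa> * \<tau> * Th) + 1))"

definition mu_W :: "real \<Rightarrow> real \<Rightarrow> real \<Rightarrow> real \<Rightarrow> real \<Rightarrow> real \<Rightarrow> real" where
  "mu_W \<kappa> Th dmin dmax p0 \<tau> =
     W_iso Th dmin dmax
     + W_ad dmin dmax p0 / (\<kappa> * \<tau>) * (1 - exp (- \<kappa> * \<tau>))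
     - (dmax - dmin) / (\<kappa> * \<tau>)
       * (G_series \<kappa> Th dmin dmax \<tau> \<tau> - exp (- \<kappa> * \<tau>) * G_series \<kappa> Th dmin dmax \<tau> 0)"

end

theory Submission
  imports Defs "HOL-Real_Asymp.Real_Asymp"
begin

text \<open>Put \<open>a = \<epsilon>/T\<^sub>h\<close>, \<open>s = \<kappa>\<tau>\<close> and \<open>H(s, q) = \<Sum>\<^sub>n (-q)\<^sup>n / (n a + s)\<close>. Cancelling \<open>s\<close> shows
  \<open>\<G>/(\<kappa>\<tau>) = - H(s, q)\<close> with \<open>q = exp (- \<delta>/T\<^sub>h) < 1\<close>, so the singular prefactor disappears.
  A geometric majorant gives \<open>H(s, q) = O(1/s)\<close> for large \<open>s\<close>, and \<open>H(s, q) = H(0, q) + O(s)\<close>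
  for small \<open>s\<close>, where \<open>H(0, q) = - ln (1 + q) / a\<close> is the Mercator series. Hence the series
  terms vanish as \<open>\<tau> \<rightarrow> \<infinity>\<close> and cancel exactly the isothermal work as \<open>\<tau> \<rightarrow> 0\<close>.\<close>

definition shifted_log_series :: "real \<Rightarrow> real \<Rightarrow> real \<Rightarrow> real" where
  "shifted_log_series a q s = (\<Sum>n. (- q) ^ Suc n / (real (Suc n) * a + s))"

text \<open>Comparison with \<open>C * q ^ n\<close>. The constant \<open>C\<close> stays explicit
  because in the applications it carries the whole dependence on \<open>s\<close>, so one majorant
  serves summability and both limits.\<close>

lemma geometric_majorant:
  fixes f :: "nat \<Rightarrow> real"
  assumes "0 < q" "q < 1" and bound: "\<And>n. \<bar>f n\<bar> \<le> C * q ^ n"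
  shows "summable f" and "\<bar>suminf f\<bar> \<le> C / (1 - q)"
proof -
  have g: "(\<lambda>n. C * q ^ n) sums (C * (1 / (1 - q)))"
    using assms by (intro sums_mult geometric_sums) auto
  have abs: "summable (\<lambda>n. \<bar>f n\<bar>)"
    using bound by (intro summable_comparison_test[OF _ sums_summable[OF g]]) auto
  then show "summable f"
    by (rule summable_rabs_cancel)
  have "\<bar>suminf f\<bar> \<le> (\<Sum>n. \<bar>f n\<bar>)"
    by (rule summable_rabs[OF abs])
  also have "\<dots> \<le> (\<Sum>n. C * q ^ n)"
    by (intro suminf_le bound abs sums_summable[OF g])
  finally show "\<bar>suminf f\<bar> \<le> C / (1 - q)"
    using sums_unique[OF g] by simp
qed

context
  fixes a q :: real
  assumes a: "0 < a" and q: "0 < q" "q < 1"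
begin

text \<open>One factor \<open>q < 1\<close> of the numerator is dropped and the denominator is
  replaced by any positive lower bound \<open>c\<close>. Taking \<open>c = a\<close> gives a bound
  uniform in \<open>s \<ge> 0\<close>, whereas \<open>c = s\<close> gives decay for large
  \<open>s\<close>.\<close>

lemma shifted_log_series_term_bound:
  assumes "0 < c" "0 \<le> s" "c \<le> real (Suc n) * a + s"
  shows "\<bar>(- q) ^ Suc n / (real (Suc n) * a + s)\<bar> \<le> 1 / c * q ^ n"
proof -
  have "\<bar>(- q) ^ Suc n / (real (Suc n) * a + s)\<bar> = q ^ Suc n / (real (Suc n) * a + s)"
    using a q assms by (simp add: abs_mult power_abs)
  also have "\<dots> \<le> q ^ n / c"
    using q assms by (intro frac_le) (auto simp: mult_le_cancel_right1)
  finally show ?thesis by simp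
qed

lemma le_Suc_mult: "a \<le> real (Suc n) * a"
  using a by (simp add: algebra_simps)

lemma summable_shifted_log_series:
  assumes "0 \<le> s"
  shows "summable (\<lambda>n. (- q) ^ Suc n / (real (Suc n) * a + s))"
proof (rule geometric_majorant(1)[OF q])
  show "\<bar>(- q) ^ Suc n / (real (Suc n) * a + s)\<bar> \<le> 1 / a * q ^ n" for n
    using le_Suc_mult[of n] assms by (intro shifted_log_series_term_bound a) auto
qed

lemma shifted_log_series_0: "shifted_log_series a q 0 = - ln (1 + q) / a"
proof -
  let ?t = "\<lambda>n. (- q) ^ Suc n / (real (Suc n) * a + 0)"
  \<comment> \<open>\<open>ln_series\<close> expands around 1 on the interval from 0 to 2, hence the
    form \<open>1 + q - 1\<close>; its terms are those of the series at \<open>s = 0\<close> scaled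
    by \<open>- a\<close>.\<close>
  have "ln (1 + q) = (\<Sum>n. (-1) ^ n * (1 / real (n + 1)) * (1 + q - 1) ^ Suc n)"
    using q by (intro ln_series) auto
  also have "(\<lambda>n. (-1) ^ n * (1 / real (n + 1)) * (1 + q - 1) ^ Suc n) = (\<lambda>n. - a * ?t n)"
  proof
    fix n
    show "(-1) ^ n * (1 / real (n + 1)) * (1 + q - 1) ^ Suc n = - a * ?t n"
      using a power_minus[of q n] by simp
  qed
  also have "(\<Sum>n. - a * ?t n) = - a * (\<Sum>n. ?t n)"
    by (rule suminf_mult[OF summable_shifted_log_series]) simp
  finally show ?thesis
    using a by (simp add: shifted_log_series_def field_simps)
qed

text \<open>Every denominator is at least \<open>s\<close>, so the term bound applies with
  \<open>c = s\<close>.\<close>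

lemma shifted_log_series_bound:
  assumes "0 < s"
  shows "\<bar>shifted_log_series a q s\<bar> \<le> 1 / s / (1 - q)"
  unfolding shifted_log_series_def
  using a assms
  by (intro geometric_majorant(2)[OF q] shifted_log_series_term_bound) auto

text \<open>With \<open>d = real (Suc n) * a\<close>, the identity 1/(d + s) - 1/d = - (s/d) / (d +
  s) extracts a factor \<open>s\<close>. One factor \<open>1 / a\<close> comes from
  \<open>a \<le> d\<close>, the other from the term bound with \<open>c = a\<close>.\<close>

lemma shifted_log_series_diff_bound:
  assumes "0 < s"
  shows "\<bar>shifted_log_series a q s - shifted_log_series a q 0\<bar> \<le> s / a\<^sup>2 / (1 - q)"
proof -
  let ?t = "\<lambda>s n. (- q) ^ Suc n / (real (Suc n) * a + s)"
  have "\<bar>?t s n - ?t 0 n\<bar> \<le> s / a\<^sup>2 * q ^ n" for n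
  proof -
    define d where "d = real (Suc n) * a"
    have d: "a \<le> d" "0 < d"
      using le_Suc_mult[of n] a unfolding d_def by auto
    have "?t s n - ?t 0 n = - (s / d) * ?t s n"
      using d assms unfolding d_def[symmetric] by (simp add: divide_simps) (simp add: algebra_simps)
    also have "\<bar>\<dots>\<bar> = s / d * \<bar>?t s n\<bar>"
      using d assms by (simp add: abs_mult)
    also have "\<dots> \<le> s / a * (1 / a * q ^ n)"
    proof (rule mult_mono)
      show "\<bar>?t s n\<bar> \<le> 1 / a * q ^ n"
        using d assms by (intro shifted_log_series_term_bound a) (auto simp: d_def)
      show "s / d \<le> s / a"
        using a d assms by (intro frac_le) auto
    qed (use a assms in auto)
    finally show ?thesis
      by (simp add: power2_eq_square)
  qed
  then have "\<bar>\<Sum>n. ?t s n - ?t 0 n\<bar> \<le> s / a\<^sup>2 / (1 - q)"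
    by (rule geometric_majorant(2)[OF q])
  then show ?thesis
    using summable_shifted_log_series[of s] summable_shifted_log_series[of 0] assms
    by (simp only: shifted_log_series_def suminf_diff less_imp_le order_refl)
qed

lemma tendsto_shifted_log_series_at_right_0:
  "(shifted_log_series a q \<longlongrightarrow> - ln (1 + q) / a) (at_right 0)"
proof -
  have "((\<lambda>s. s / a\<^sup>2 / (1 - q)) \<longlongrightarrow> 0 / a\<^sup>2 / (1 - q)) (at_right 0)"
    using a q by (intro tendsto_intros) auto
  then have lim: "((\<lambda>s. s / a\<^sup>2 / (1 - q)) \<longlongrightarrow> 0) (at_right 0)"
    by simp
  have "eventually (\<lambda>s. norm (shifted_log_series a q s - shifted_log_series a q 0)
      \<le> norm (s / a\<^sup>2 / (1 - q)) * 1) (at_right 0)"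
    using eventually_at_right_less[of 0]
    by eventually_elim (use q shifted_log_series_diff_bound in simp)
  with lim have "((\<lambda>s. shifted_log_series a q s - shifted_log_series a q 0) \<longlongrightarrow> 0) (at_right 0)"
    by (rule tendsto_0_le)
  then show ?thesis
    unfolding shifted_log_series_0 by (rule LIM_zero_cancel)
qed

lemma tendsto_shifted_log_series_at_top: "(shifted_log_series a q \<longlongrightarrow> 0) at_top"
proof -
  have "((\<lambda>s. 1 / s / (1 - q)) \<longlongrightarrow> 0 / (1 - q)) at_top"
    using q by (intro tendsto_intros tendsto_divide_0[OF tendsto_const]
        filterlim_at_top_imp_at_infinity filterlim_ident) auto
  then have lim: "((\<lambda>s. 1 / s / (1 - q)) \<longlongrightarrow> 0) at_top"
    by simp
  have "eventually (\<lambda>s. norm (shifted_log_series a q s) \<le> norm (1 / s / (1 - q)) * 1) at_top"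
    using eventually_gt_at_top[of 0]
    by eventually_elim (use q shifted_log_series_bound in simp)
  with lim show ?thesis
    by (rule tendsto_0_le)
qed

end

text \<open>Each denominator of \<open>G_series\<close> is
  \<open>(real (Suc n) * a + s) / s\<close>, so every term carries a factor \<open>s\<close>.
  Positivity of the gap gives \<open>q < 1\<close>, hence the summability needed to pull this factor
  out of the sum.\<close>

lemma G_series_eq_shifted_log_series:
  assumes "0 < \<kappa>" "0 < Th" "dmin < dmax" "0 < \<tau>" "0 < gap dmin dmax \<tau> t"
  shows "G_series \<kappa> Th dmin dmax \<tau> t / (\<kappa> * \<tau>)
    = - shifted_log_series ((dmax - dmin) / Th) (exp (- gap dmin dmax \<tau> t / Th)) (\<kappa> * \<tau>)"
proof -
  define a where "a = (dmax - dmin) / Th"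
  define q where "q = exp (- gap dmin dmax \<tau> t / Th)"
  define s where "s = \<kappa> * \<tau>"
  have pos: "0 < a" "0 < s"
    using assms by (auto simp: a_def s_def)
  have q: "0 < q" "q < 1"
    using assms by (auto simp: q_def)
  have "(- q) ^ Suc n / (real (Suc n) * (dmax - dmin) / (s * Th) + 1)
      = s * ((- q) ^ Suc n / (real (Suc n) * a + s))" for n
  proof -
    have "real (Suc n) * (dmax - dmin) / (s * Th) + 1 = (real (Suc n) * a + s) / s"
      using pos assms by (simp add: a_def field_simps)
    then show ?thesis by simp
  qed
  then have "G_series \<kappa> Th dmin dmax \<tau> t = - (\<Sum>n. s * ((- q) ^ Suc n / (real (Suc n) * a + s)))"
    by (simp only: G_series_def q_def s_def)
  also have "\<dots> = - (s * shifted_log_series a q s)"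
    unfolding shifted_log_series_def
    using summable_shifted_log_series[OF pos(1) q, of s] pos(2)
    by (simp only: suminf_mult less_imp_le)
  finally show ?thesis
    using assms(1,4) by (simp add: a_def q_def s_def)
qed

theorem corollary1:
  fixes \<kappa> Th dmin dmax p0 :: real
  assumes "\<kappa> > 0" and "Th > 0"
    and "0 < dmin" and "dmin < dmax"
    and "0 \<le> p0" and "p0 \<le> 1"
  shows "(mu_W \<kappa> Th dmin dmax p0 \<longlongrightarrow> W_ad dmin dmax p0) (at_right 0)
       \<and> (mu_W \<kappa> Th dmin dmax p0 \<longlongrightarrow> W_iso Th dmin dmax) at_top"
proof -
  define a where "a = (dmax - dmin) / Th"
  define x where "x = exp (- dmin / Th)"
  define y where "y = exp (- dmax / Th)"
  define H where "H = shifted_log_series a"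
  have a: "0 < a" and x: "0 < x" "x < 1" and y: "0 < y" "y < 1"
    using assms by (auto simp: a_def x_def y_def)
  have eps: "dmax - dmin = Th * a"
    using assms(2) by (simp add: a_def)
  \<comment> \<open>At the end points \<open>t = \<tau>\<close> and \<open>t = 0\<close> the gap is
    \<open>dmin\<close> and \<open>dmax\<close>, whatever \<tau> is. So \<open>x\<close> and
    \<open>y\<close> are constants and the work depends on \<tau> only through
    \<open>s = \<kappa> * \<tau>\<close>.\<close>
  define M where "M s = W_iso Th dmin dmax + W_ad dmin dmax p0 * ((1 - exp (- s)) / s)
      + (dmax - dmin) * (H x s - exp (- s) * H y s)" for s
  have mu: "mu_W \<kappa> Th dmin dmax p0 \<tau> = M (\<kappa> * \<tau>)" if "0 < \<tau>" for \<tau>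
  proof -
    have "mu_W \<kappa> Th dmin dmax p0 \<tau> = W_iso Th dmin dmax
        + W_ad dmin dmax p0 * ((1 - exp (- (\<kappa> * \<tau>))) / (\<kappa> * \<tau>))
        - (dmax - dmin) * (G_series \<kappa> Th dmin dmax \<tau> \<tau> / (\<kappa> * \<tau>)
          - exp (- (\<kappa> * \<tau>)) * (G_series \<kappa> Th dmin dmax \<tau> 0 / (\<kappa> * \<tau>)))"
      using that assms(1) by (simp add: mu_W_def field_simps)
    also have "G_series \<kappa> Th dmin dmax \<tau> \<tau> / (\<kappa> * \<tau>) = - H x (\<kappa> * \<tau>)"
      using G_series_eq_shifted_log_series[OF assms(1,2,4) that, of \<tau>] that assms(3)
      by (simp add: gap_def H_def a_def x_def)
    also have "G_series \<kappa> Th dmin dmax \<tau> 0 / (\<kappa> * \<tau>) = - H y (\<kappa> * \<tau>)"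
      using G_series_eq_shifted_log_series[OF assms(1,2,4) that, of 0] assms(3,4)
      by (simp add: gap_def H_def a_def y_def)
    finally show ?thesis
      by (simp add: M_def algebra_simps)
  qed
  have iso: "W_iso Th dmin dmax = Th * (ln (1 + x) - ln (1 + y))"
    using x y unfolding W_iso_def partition_fun_def x_def[symmetric] y_def[symmetric]
    by (simp add: ln_div)
  have "((\<lambda>s::real. (1 - exp (- s)) / s) \<longlongrightarrow> 1) (at_right 0)"
    by real_asymp
  moreover have "((\<lambda>s::real. exp (- s)) \<longlongrightarrow> 1) (at_right 0)"
    by real_asymp
  ultimately have "(M \<longlongrightarrow> W_iso Th dmin dmax + W_ad dmin dmax p0 * 1
      + (dmax - dmin) * (- ln (1 + x) / a - 1 * (- ln (1 + y) / a))) (at_right 0)"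
    unfolding M_def H_def
    by (intro tendsto_intros tendsto_shifted_log_series_at_right_0 a x y)
  \<comment> \<open>Since \<open>dmax - dmin = Th * a\<close>, the series part equals
    \<open>- Th * (ln (1 + x) - ln (1 + y))\<close>, the negative of the isothermal work.\<close>
  also have "W_iso Th dmin dmax + W_ad dmin dmax p0 * 1
      + (dmax - dmin) * (- ln (1 + x) / a - 1 * (- ln (1 + y) / a)) = W_ad dmin dmax p0"
    using a by (simp add: iso eps algebra_simps)
  finally have M0: "(M \<longlongrightarrow> W_ad dmin dmax p0) (at_right 0)" .
  have "((\<lambda>s::real. (1 - exp (- s)) / s) \<longlongrightarrow> 0) at_top"
    by real_asymp
  moreover have "((\<lambda>s::real. exp (- s)) \<longlongrightarrow> 0) at_top"
    by real_asymp
  ultimately have "(M \<longlongrightarrow> W_iso Th dmin dmax + W_ad dmin dmax p0 * 0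
      + (dmax - dmin) * (0 - 0 * 0)) at_top"
    unfolding M_def H_def
    by (intro tendsto_intros tendsto_shifted_log_series_at_top a x y)
  then have Mtop: "(M \<longlongrightarrow> W_iso Th dmin dmax) at_top"
    by simp
  have scale0: "filterlim (\<lambda>\<tau>. \<kappa> * \<tau>) (at_right 0) (at_right 0)"
    using assms(1) by real_asymp
  have scaletop: "filterlim (\<lambda>\<tau>. \<kappa> * \<tau>) at_top at_top"
    using assms(1) by real_asymp
  show ?thesis
  proof
    \<comment> \<open>The identity \<open>mu\<close> is available only for positive \<tau>, which
      holds eventually along both filters.\<close>
    have "eventually (\<lambda>\<tau>. M (\<kappa> * \<tau>) = mu_W \<kappa> Th dmin dmax p0 \<tau>) (at_right 0)"
      by (auto simp: mu intro!: eventually_at_rightI[of 0 1])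
    then show "(mu_W \<kappa> Th dmin dmax p0 \<longlongrightarrow> W_ad dmin dmax p0) (at_right 0)"
      by (rule Lim_transform_eventually[OF filterlim_compose[OF M0 scale0]])
    have "eventually (\<lambda>\<tau>. M (\<kappa> * \<tau>) = mu_W \<kappa> Th dmin dmax p0 \<tau>) at_top"
      by (auto simp: mu intro!: eventually_mono[OF eventually_gt_at_top[of 0]])
    then show "(mu_W \<kappa> Th dmin dmax p0 \<longlongrightarrow> W_iso Th dmin dmax) at_top"
      by (rule Lim_transform_eventually[OF filterlim_compose[OF Mtop scaletop]])
  qed
qed

end
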